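(* Let $G$ be an abelian Polish group that is not locally compact. Then there exists a Borel Haar null set $B \subset G$ that is not contained in any $G_\delta$ Haar null subset of $G$; that is, there is no $G_\delta$ set $H \subset G$ that is Haar null and satisfies $B \subset H$.
   Context: An abelian Polish group is an abelian topological group (written additively) whose topology is separable and completely metrizable. A set $X \subset G$ is called Haar null if there exist a Borel set $B' \supset X$ and a Borel probability measure $\mu$ on $G$ such that $\mu(B'+g)=0$ for every $g \in G$. A $G_\delta$ set is a countable intersection of open sets. *)

theory Defs
  imports "HOL-Probability.Probability"
begin

definition haar_null :: "'a::topological_ab_group_add set \<Rightarrow> bool" where
  "haar_null X \<longleftrightarrow>
     (\<exists>B' \<mu>. B' \<in> sets borel \<and> X \<subseteq> B' \<and>
        prob_space \<mu> \<and> sets \<mu> = sets borel \<and>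
        (\<forall>g. emeasure \<mu> ((\<lambda>x. x + g) ` B') = 0))"

text \<open>
  \<^const>\<open>emeasure\<close> returns 0 on non-measurable sets. The definition is not affected:
  translations are homeomorphisms, so every translate of a Borel set is Borel.
\<close>

lemma translate_borel:
  fixes B :: "'a::topological_ab_group_add set"
  assumes "B \<in> sets borel"
  shows "(\<lambda>x. x + g) ` B \<in> sets borel"
proof -
  have "(\<lambda>x. x + g) ` B = (\<lambda>x. x + - g) -` B \<inter> space borel"
    by (auto simp: image_iff) (metis diff_add_cancel)
  moreover have "(\<lambda>x::'a. x + - g) \<in> borel_measurable borel"
    by (intro borel_measurable_continuous_onI continuous_on_add continuous_on_id continuous_on_const)
  ultimately show ?thesis
    using assms by (metis measurable_sets)
qed

end

theory Submission
  imports Defs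
begin

text \<open>
  Let \<open>x\<close> range over codes for pairs of a compact set \<open>K x\<close> and a sequence \<open>U n x\<close> of open sets.
  Since no neighbourhood of \<open>0\<close> is totally bounded, one can choose translations \<open>t x\<close> such that
  the sets \<open>t x + K x\<close> are so far apart that every translate of a fixed Cantor set, consisting of
  the sums \<open>S e\<close>, meets at most one of them. Choose in a Borel way one point of
  \<open>t x + K x\<close> outside \<open>U n x\<close>, whenever there is one, and let \<open>B n\<close> be the set of these points.
  The coin-tossing measure on the Cantor set has no atoms, so it witnesses that
  the union of the \<open>B n\<close> is Haar null. If a \<open>G\<^sub>\<delta>\<close> set \<open>H\<close>, the intersection of open sets \<open>O n\<close>,
  contains all \<open>B n\<close> and \<open>C\<close> is compact, let \<open>x\<close> code \<open>C\<close> and \<open>O\<close>: as no point of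
  \<open>t x + K x\<close> was chosen outside \<open>O n\<close>, the translate \<open>t x + C\<close> is contained in \<open>H\<close>. A set
  containing a translate of every compact set is not Haar null, because Borel probability
  measures on Polish spaces are tight.
\<close>

section \<open>Completeness and total boundedness in abelian Polish groups\<close>

lemma nhd_halving:
  fixes U :: "'a::topological_ab_group_add set"
  assumes "open U" "0 \<in> U"
  obtains W where "open W" "0 \<in> W" "\<And>a. a \<in> W \<Longrightarrow> - a \<in> W"
    "\<And>a b. a \<in> W \<Longrightarrow> b \<in> W \<Longrightarrow> a + b \<in> U"
proof -
  have "open ((\<lambda>p::'a \<times> 'a. fst p + snd p) -` U)"
    by (intro open_vimage assms continuous_intros)
  moreover have "(0, 0) \<in> (\<lambda>p::'a \<times> 'a. fst p + snd p) -` U"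
    using assms by simp
  ultimately obtain A B where AB: "open A" "open B" "(0, 0) \<in> A \<times> B"
      "A \<times> B \<subseteq> (\<lambda>p::'a \<times> 'a. fst p + snd p) -` U"
    by (rule open_prod_elim)
  let ?C = "A \<inter> B"
  have "open (uminus -` ?C)"
    by (intro open_vimage open_Int AB continuous_intros)
  then have "open (?C \<inter> uminus -` ?C)"
    using AB by (intro open_Int)
  then show thesis
  proof (rule that)
    show "a + b \<in> U" if "a \<in> ?C \<inter> uminus -` ?C" "b \<in> ?C \<inter> uminus -` ?C" for a b
      using AB(4) that by force
  qed (use AB(3) in auto)
qed

lemma open_translate_vimage:
  fixes U :: "'a::topological_ab_group_add set"
  assumes "open U"
  shows "open {v. c + v \<in> U}" "open {v. v - c \<in> U}" "open {v. c - v \<in> U}"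
proof -
  have "open ((\<lambda>v. c + v) -` U)" "open ((\<lambda>v. v - c) -` U)" "open ((\<lambda>v. c - v) -` U)"
    by (intro open_vimage assms continuous_intros)+
  then show "open {v. c + v \<in> U}" "open {v. v - c \<in> U}" "open {v. c - v \<in> U}"
    by (auto simp: vimage_def)
qed

text \<open>
  The complete metric of the space need not be invariant. By Baire category some translate
  of a sequence that is Cauchy for the group uniformity is Cauchy for that metric.
\<close>

lemma group_Cauchy_convergent:
  fixes x :: "nat \<Rightarrow> 'a::{topological_ab_group_add, complete_space}"
  assumes Cauchy: "\<And>W. open W \<Longrightarrow> 0 \<in> W \<Longrightarrow> \<exists>N. \<forall>m\<ge>N. \<forall>n\<ge>N. x m - x n \<in> W"
  shows "convergent x"
proof -
  define small where "small g k P N \<longleftrightarrow> open P \<and> g \<in> P \<and>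
      (\<forall>h\<in>P. \<forall>m\<ge>N. \<forall>n\<ge>N. dist (x m - h) (x n - h) < 1 / real (Suc k))" for g k P and N :: nat
  define E where "E k = {g. \<exists>P N. small g k P N}" for k
  have "open (E k)" for k
    unfolding open_subopen[of "E k"]
  proof
    fix g assume "g \<in> E k"
    then obtain P N where P: "small g k P N"
      by (auto simp: E_def)
    then have "P \<subseteq> E k"
      unfolding E_def small_def by blast
    with P show "\<exists>T. open T \<and> g \<in> T \<and> T \<subseteq> E k"
      unfolding small_def by blast
  qed
  moreover have "closure (E k) = UNIV" for k
  proof -
    have "\<exists>g\<in>E k. g \<in> O'" if O: "open O'" "g0 \<in> O'" for g0 O'
    proof -
      obtain m where m: "\<And>n. n \<ge> m \<Longrightarrow> x n - x m \<in> {v. g0 + v \<in> O'}"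
        using Cauchy[of "{v. g0 + v \<in> O'}"] O open_translate_vimage(1) by fastforce
      define c where "c = g0 - x m"
      define r where "r = 1 / (2 * real (Suc k))"
      have r: "r > 0" "r + r = 1 / real (Suc k)"
        by (simp_all add: r_def field_simps)
      have "open {v. v - c \<in> ball (- c) r}" "0 \<in> {v. v - c \<in> ball (- c) r}"
        using r open_translate_vimage(2)[of "ball (- c) r" c] by auto
      then obtain W where W: "open W" "0 \<in> W" "\<And>a. a \<in> W \<Longrightarrow> - a \<in> W"
        "\<And>a b. a \<in> W \<Longrightarrow> b \<in> W \<Longrightarrow> a + b \<in> {v. v - c \<in> ball (- c) r}"
        by (rule nhd_halving) blast
      obtain N0 where N0: "\<And>n n'. n \<ge> N0 \<Longrightarrow> n' \<ge> N0 \<Longrightarrow> x n - x n' \<in> W"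
        using Cauchy W by meson
      define N where "N = max m N0"
      \<comment> \<open>This makes \<open>x N - g\<close> equal to \<open>- c\<close>, a point fixed
        before \<open>N\<close> is known; hence \<open>r\<close> and \<open>W\<close> can be chosen
        before \<open>N\<close>. As \<open>N \<ge> m\<close>, the point \<open>g\<close> stays in
        \<open>O'\<close>.\<close>
      define g where "g = g0 + (x N - x m)"
      define P where "P = {h. g - h \<in> W}"
      have near: "x n - h \<in> ball (- c) r" if "h \<in> P" "n \<ge> N" for h n
      proof -
        have "(x n - x N) + (g - h) \<in> {v. v - c \<in> ball (- c) r}"
          using that N0 by (intro W) (auto simp: P_def N_def)
        moreover have "(x n - x N) + (g - h) - c = x n - h"
          by (simp add: g_def c_def algebra_simps)
        ultimately show ?thesis by simp
      qed
      have "dist (x n - h) (x n' - h) < 1 / real (Suc k)" if "h \<in> P" "n \<ge> N" "n' \<ge> N" for h n n'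
        using near[OF that(1,2)] near[OF that(1,3)] r(2) dist_triangle2[of "x n - h" "x n' - h" "- c"]
        by (auto simp: dist_commute)
      then have "small g k P N"
        unfolding small_def P_def using W open_translate_vimage(3) by auto
      then have "g \<in> E k"
        by (auto simp: E_def)
      moreover have "g \<in> O'"
        using m[of N] by (auto simp: g_def N_def)
      ultimately show ?thesis by blast
    qed
    then show ?thesis
      unfolding closure_iff_nhds_not_empty set_eq_iff by (auto simp: disjoint_iff) (meson subsetD)
  qed
  ultimately have "euclidean closure_of (\<Inter> (range E)) = topspace (euclidean :: 'a topology)"
    by (intro Baire_category) (auto simp: completely_metrizable_space_euclidean)
  then have "\<Inter> (range E) \<noteq> {}"
    by auto
  then obtain g where g: "g \<in> E k" for k
    by blast
  have "Cauchy (\<lambda>n. x n - g)"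
  proof (rule metric_CauchyI)
    fix e :: real assume "e > 0"
    then obtain k where k: "1 / real (Suc k) < e"
      using nat_approx_posE by metis
    obtain P N where "small g k P N"
      using g[of k] by (auto simp: E_def)
    then show "\<exists>N. \<forall>m\<ge>N. \<forall>n\<ge>N. dist (x m - g) (x n - g) < e"
      unfolding small_def using k by (meson less_trans)
  qed
  then obtain l where "(\<lambda>n. x n - g) \<longlonglongrightarrow> l"
    using Cauchy_convergent_iff convergent_def by blast
  then have "(\<lambda>n. x n - g + g) \<longlonglongrightarrow> l + g"
    by (intro tendsto_intros)
  then show ?thesis
    by (auto simp: convergent_def)
qed

text \<open>The sets \<open>V i\<close> replace the balls of radius \<open>2^-i\<close> of a
  translation-invariant metric; each sum or difference of two elements costs one level.\<close>

locale nhd_chain =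
  fixes V :: "nat \<Rightarrow> 'a::{topological_ab_group_add, polish_space} set"
  assumes V_open: "open (V i)"
    and V_zero: "0 \<in> V i"
    and V_minus: "a \<in> V i \<Longrightarrow> - a \<in> V i"
    and V_add: "a \<in> V (Suc i) \<Longrightarrow> b \<in> V (Suc i) \<Longrightarrow> a + b \<in> V i"
    and V_base: "open U \<Longrightarrow> 0 \<in> U \<Longrightarrow> \<exists>i. V i \<subseteq> U"
begin

lemma V_Suc: "V (Suc i) \<subseteq> V i"
  using V_add[OF _ V_zero] by auto

lemma V_antimono: "i \<le> j \<Longrightarrow> V j \<subseteq> V i"
  using lift_Suc_antimono_le[of V] V_Suc by blast

lemma V_diff: "a \<in> V (Suc i) \<Longrightarrow> b \<in> V (Suc i) \<Longrightarrow> a - b \<in> V i"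
  using V_add[of a i "- b"] V_minus by simp

lemma V_add_le: "a \<in> V m \<Longrightarrow> b \<in> V n \<Longrightarrow> i < m \<Longrightarrow> i < n \<Longrightarrow> a + b \<in> V i"
  using V_add[of a i b] V_antimono[of "Suc i" m] V_antimono[of "Suc i" n] by auto

lemma V_diff_le: "a \<in> V m \<Longrightarrow> b \<in> V n \<Longrightarrow> i < m \<Longrightarrow> i < n \<Longrightarrow> a - b \<in> V i"
  using V_diff[of a i b] V_antimono[of "Suc i" m] V_antimono[of "Suc i" n] by auto

text \<open>A point of the closure differs from a point of the set by an element of
  \<open>V (Suc i)\<close>.\<close>

lemma closure_V: "closure (V (Suc i)) \<subseteq> V i"
proof
  fix a assume a: "a \<in> closure (V (Suc i))"
  have "open {b. a - b \<in> V (Suc i)}" "a \<in> {b. a - b \<in> V (Suc i)}"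
    using V_open V_zero open_translate_vimage(3) by auto
  with a obtain b where "b \<in> V (Suc i)" "a - b \<in> V (Suc i)"
    using open_Int_closure_eq_empty[of "{b. a - b \<in> V (Suc i)}" "V (Suc i)"] by blast
  then show "a \<in> V i"
    using V_add[of "a - b" i b] by simp
qed

lemma tendstoI_V:
  assumes "\<And>i. eventually (\<lambda>m. x m - l \<in> V i) F"
  shows "(x \<longlongrightarrow> l) F"
proof (rule topological_tendstoI)
  fix U assume "open U" "l \<in> U"
  then obtain i where "V i \<subseteq> {v. l + v \<in> U}"
    using V_base[of "{v. l + v \<in> U}"] open_translate_vimage(1) by auto
  then have "x m - l \<in> V i \<Longrightarrow> x m \<in> U" for m
    by fastforce
  then show "eventually (\<lambda>m. x m \<in> U) F"
    using assms[of i] by (auto elim: eventually_mono)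
qed

lemma tendstoD_V:
  assumes "(x \<longlongrightarrow> l) F"
  shows "eventually (\<lambda>m. x m - l \<in> V i) F"
proof -
  have "((\<lambda>m. x m - l) \<longlongrightarrow> l - l) F"
    using assms by (intro tendsto_intros)
  then show ?thesis
    using V_open V_zero by (auto dest: topological_tendstoD)
qed

lemma convergentI_V:
  assumes "\<And>i. \<exists>N. \<forall>m\<ge>N. \<forall>n\<ge>N. x m - x n \<in> V i"
  shows "convergent x"
proof (rule group_Cauchy_convergent)
  fix W :: "'a set" assume "open W" "0 \<in> W"
  then obtain i where "V i \<subseteq> W"
    using V_base by blast
  then show "\<exists>N. \<forall>m\<ge>N. \<forall>n\<ge>N. x m - x n \<in> W"
    using assms[of i] by blast
qed

text \<open>Pigeonhole at each level, a diagonal subsequence, and completeness for the group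
  uniformity. Only eventual approximation is demanded, so that the lemma applies to points of sets
  \<open>K (X m)\<close> with varying codes \<open>X m\<close>.\<close>

lemma totally_bounded_convergent_subseq:
  fixes x :: "nat \<Rightarrow> 'a"
  assumes tb: "\<And>i. \<exists>D. finite D \<and> eventually (\<lambda>m. \<exists>d\<in>D. x m - d \<in> V i) sequentially"
  shows "\<exists>r l. strict_mono (r :: nat \<Rightarrow> nat) \<and> (x \<circ> r) \<longlonglongrightarrow> l"
proof -
  define P where "P i s \<longleftrightarrow> (\<exists>d. \<forall>m. x (s m) - d \<in> V i)" for i and s :: "nat \<Rightarrow> nat"
  interpret subseqs P
  proof
    fix n and s :: "nat \<Rightarrow> nat" assume s: "strict_mono s"
    obtain D where D: "finite D" "eventually (\<lambda>m. \<exists>d\<in>D. x m - d \<in> V n) sequentially"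
      using tb by blast
    then have "eventually (\<lambda>m. \<exists>d\<in>D. x (s m) - d \<in> V n) sequentially"
      using s filterlim_subseq eventually_compose_filterlim by blast
    then obtain N where N: "\<And>m. m \<ge> N \<Longrightarrow> \<exists>d\<in>D. x (s m) - d \<in> V n"
      by (auto simp: eventually_sequentially)
    have "infinite {N..}"
      by (rule infinite_Ici)
    then obtain d where d: "d \<in> D" "infinite {m \<in> {N..}. x (s m) - d \<in> V n}"
      using pigeonhole_infinite_rel[OF _ D(1), of "{N..}" "\<lambda>m d. x (s m) - d \<in> V n"] N by auto
    let ?I = "{m \<in> {N..}. x (s m) - d \<in> V n}"
    have "strict_mono (enumerate ?I)" "\<forall>m. enumerate ?I m \<in> ?I"
      using d strict_mono_enumerate enumerate_in_set by blast+
    then show "\<exists>r'. strict_mono r' \<and> P n (s \<circ> r')"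
      unfolding P_def by (intro exI[of _ "enumerate ?I"]) auto
  qed
  have P: "P k (diagseq \<circ> ((+) (Suc k)))" for k
    by (rule diagseq_holds) (auto simp: P_def)
  have "convergent (x \<circ> diagseq)"
  proof (rule convergentI_V)
    fix i
    \<comment> \<open>The diagonal sequence obeys level \<open>Suc i\<close> from index
      \<open>Suc (Suc i)\<close> on; one level is lost in taking differences.\<close>
    obtain d where d: "\<And>m. x (diagseq (Suc (Suc i) + m)) - d \<in> V (Suc i)"
      using P[of "Suc i"] by (auto simp: P_def)
    have "(x \<circ> diagseq) m - (x \<circ> diagseq) n \<in> V i" if "m \<ge> Suc (Suc i)" "n \<ge> Suc (Suc i)" for m n
      using V_diff[OF d[of "m - Suc (Suc i)"] d[of "n - Suc (Suc i)"]] that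
      unfolding le_add_diff_inverse[OF that(1)] le_add_diff_inverse[OF that(2)] by simp
    then show "\<exists>N. \<forall>m\<ge>N. \<forall>n\<ge>N. (x \<circ> diagseq) m - (x \<circ> diagseq) n \<in> V i"
      by blast
  qed
  then show ?thesis
    using subseq_diagseq by (auto simp: convergent_def)
qed

text \<open>Total boundedness of \<open>V i\<close> makes the closure of \<open>V (Suc i)\<close>
  compact, and its translates are compact neighbourhoods. The contrapositive supplies the room for
  the separated vectors below.\<close>

lemma locally_compact_if_V_totally_bounded:
  assumes "\<And>j. \<exists>D. finite D \<and> (\<forall>v\<in>V i. \<exists>d\<in>D. v - d \<in> V j)"
  shows "locally_compact_space (euclidean :: 'a topology)"
proof -
  let ?K = "closure (V (Suc i))"
  have "seq_compact ?K"
  proof (rule seq_compactI)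
    fix f :: "nat \<Rightarrow> 'a" assume f: "\<forall>n. f n \<in> ?K"
    have "\<exists>D. finite D \<and> eventually (\<lambda>m. \<exists>d\<in>D. f m - d \<in> V j) sequentially" for j
    proof -
      obtain D where "finite D" "\<And>v. v \<in> V i \<Longrightarrow> \<exists>d\<in>D. v - d \<in> V j"
        using assms[of j] by metis
      moreover have "f m \<in> V i" for m
        using f closure_V by blast
      ultimately show ?thesis
        by (intro exI[of _ D]) simp
    qed
    then obtain r l where "strict_mono (r :: nat \<Rightarrow> nat)" "(f \<circ> r) \<longlonglongrightarrow> l"
      using totally_bounded_convergent_subseq by blast
    moreover have "l \<in> ?K"
    proof (rule closed_sequentially[OF closed_closure])
      show "(f \<circ> r) n \<in> ?K" for n
        using f by simp
    qed fact
    ultimately show "\<exists>l\<in>?K. \<exists>r. strict_mono r \<and> (f \<circ> r) \<longlonglongrightarrow> l"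
      by blast
  qed
  then have K: "compact ?K"
    by (simp add: compact_eq_seq_compact_metric)
  show ?thesis
    unfolding locally_compact_space_def
  proof
    fix x :: 'a
    have "compact ((+) x ` ?K)"
      using K by (intro compact_continuous_image continuous_intros)
    moreover have "{v. v - x \<in> V (Suc i)} \<subseteq> (+) x ` ?K"
      using closure_subset by (force simp: image_iff)
    moreover have "open {v. v - x \<in> V (Suc i)}" "x \<in> {v. v - x \<in> V (Suc i)}"
      using V_open V_zero open_translate_vimage(2) by auto
    ultimately show "\<exists>U K. openin euclidean U \<and> compactin euclidean K \<and> x \<in> U \<and> U \<subseteq> K"
      by (metis compactin_euclidean_iff open_openin)
  qed
qed

end

lemma ex_nhd_chain:
  "\<exists>V :: nat \<Rightarrow> 'a::{topological_ab_group_add, polish_space} set. nhd_chain V"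
proof -
  define good where "good n W \<longleftrightarrow> open W \<and> 0 \<in> W \<and> (\<forall>a\<in>W. - a \<in> W) \<and>
     W \<subseteq> ball 0 (1 / real (Suc n))" for n and W :: "'a set"
  have step: "\<exists>W. good n W \<and> (\<forall>a\<in>W. \<forall>b\<in>W. a + b \<in> U)" if U: "open U" "0 \<in> U" for n U
  proof -
    obtain W where W: "open W" "0 \<in> W" "\<And>a. a \<in> W \<Longrightarrow> - a \<in> W"
      "\<And>a b. a \<in> W \<Longrightarrow> b \<in> W \<Longrightarrow> a + b \<in> U \<inter> ball 0 (1 / real (Suc n))"
    proof (rule nhd_halving[of "U \<inter> ball 0 (1 / real (Suc n))"])
      show "open (U \<inter> ball 0 (1 / real (Suc n)))" "0 \<in> U \<inter> ball 0 (1 / real (Suc n))"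
        using U by auto
    qed blast
    moreover have "W \<subseteq> ball 0 (1 / real (Suc n))"
      using W(4)[OF _ W(2)] by auto
    ultimately show ?thesis
      unfolding good_def by blast
  qed
  have "\<exists>W. good 0 W"
    using step[of UNIV 0] by auto
  moreover have "\<exists>W'. good (Suc n) W' \<and> (\<forall>a\<in>W'. \<forall>b\<in>W'. a + b \<in> W)" if "good n W" for n W
    using step[of W "Suc n"] that unfolding good_def by blast
  ultimately obtain V where V: "\<And>n. good n (V n)"
      "\<And>n. \<forall>a\<in>V (Suc n). \<forall>b\<in>V (Suc n). a + b \<in> V n"
    using dependent_nat_choice[of good "\<lambda>n W W'. \<forall>a\<in>W'. \<forall>b\<in>W'. a + b \<in> W"] by metis
  have "nhd_chain V"
  proof
    fix U :: "'a set" assume "open U" "0 \<in> U"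
    then obtain e where e: "e > 0" "ball 0 e \<subseteq> U"
      by (meson open_contains_ball)
    then obtain n where "1 / real (Suc n) < e"
      using nat_approx_posE by metis
    then have "V n \<subseteq> U"
      using V(1)[of n] e subset_ball[of "1 / real (Suc n)" e 0] unfolding good_def by force
    then show "\<exists>i. V i \<subseteq> U" ..
  qed (use V in \<open>auto simp: good_def\<close>)
  then show ?thesis
    by blast
qed

lemma (in nhd_chain) nhd_chain_subseq:
  assumes "strict_mono r"
  shows "nhd_chain (\<lambda>i. V (r i))"
proof
  fix i a b assume "a \<in> V (r (Suc i))" "b \<in> V (r (Suc i))"
  moreover have "V (r (Suc i)) \<subseteq> V (Suc (r i))"
    using assms by (intro V_antimono Suc_leI) (simp add: strict_mono_def)
  ultimately show "a + b \<in> V (r i)"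
    using V_add by blast
next
  fix U :: "'a set" assume "open U" "0 \<in> U"
  then obtain i where "V i \<subseteq> U"
    using V_base by blast
  moreover have "V (r i) \<subseteq> V i"
    using assms by (intro V_antimono seq_suble)
  ultimately show "\<exists>i. V (r i) \<subseteq> U"
    by blast
qed (use V_open V_zero V_minus in auto)

text \<open>For each \<open>i\<close> there is some \<open>V j\<close> of which no finitely many
  translates cover \<open>V i\<close>; thinning out the chain turns \<open>j\<close> into
  \<open>Suc i\<close>.\<close>

lemma ex_noncovering_nhd_chain:
  assumes "\<not> locally_compact_space (euclidean :: 'a::{topological_ab_group_add, polish_space} topology)"
  shows "\<exists>V :: nat \<Rightarrow> 'a set. nhd_chain V \<and>
    (\<forall>i D. finite D \<longrightarrow> (\<exists>v\<in>V i. \<forall>d\<in>D. v - d \<notin> V (Suc i)))"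
proof -
  obtain V :: "nat \<Rightarrow> 'a set" where "nhd_chain V"
    using ex_nhd_chain by blast
  then interpret nhd_chain V .
  have "\<exists>j>i. \<forall>D. finite D \<longrightarrow> (\<exists>v\<in>V i. \<forall>d\<in>D. v - d \<notin> V j)" for i
  proof -
    obtain j where j: "\<And>D. finite D \<Longrightarrow> \<exists>v\<in>V i. \<forall>d\<in>D. v - d \<notin> V j"
      using locally_compact_if_V_totally_bounded[of i] assms by metis
    have "V (Suc (max i j)) \<subseteq> V j"
      by (intro V_antimono) simp
    with j have "\<forall>D. finite D \<longrightarrow> (\<exists>v\<in>V i. \<forall>d\<in>D. v - d \<notin> V (Suc (max i j)))"
      by (meson subsetD)
    then show ?thesis
      by (intro exI[of _ "Suc (max i j)"]) auto
  qed
  then obtain r where r: "\<And>n. r n < r (Suc n)"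
      "\<And>n. \<forall>D. finite D \<longrightarrow> (\<exists>v\<in>V (r n). \<forall>d\<in>D. v - d \<notin> V (r (Suc n)))"
    using dependent_nat_choice[of "\<lambda>_ _. True"
        "\<lambda>_ i j. j > i \<and> (\<forall>D. finite D \<longrightarrow> (\<exists>v\<in>V i. \<forall>d\<in>D. v - d \<notin> V j))"] by metis
  have "nhd_chain (\<lambda>i. V (r i))"
    using r by (intro nhd_chain_subseq) (simp add: strict_mono_Suc_iff)
  then show ?thesis
    using r(2) by (intro exI[of _ "\<lambda>i. V (r i)"]) auto
qed

section \<open>Separated translates of compact sets\<close>

text \<open>
  Consecutive levels are six neighbourhoods apart: this absorbs the error terms (tails of four
  series, two closures and the slack itself) in the lemma \<open>separation\<close> below. The vectors
  \<open>\<tau> i k\<close> have to be separated by the finite sets that approximate, at level \<open>i\<close>, the coded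
  compact sets and the compact set of all sums of subfamilies of \<open>w\<close>.
\<close>

locale compact_coding = nhd_chain V
  for V :: "nat \<Rightarrow> 'a::{topological_ab_group_add, polish_space} set" +
  fixes d w :: "nat \<Rightarrow> 'a" and \<tau> :: "nat \<Rightarrow> nat \<Rightarrow> 'a"
  assumes d_dense: "open U \<Longrightarrow> U \<noteq> {} \<Longrightarrow> \<exists>j. d j \<in> U"
    and w_in: "w i \<in> V (6 * i)"
    and w_notin: "w i \<notin> V (6 * i + 1)"
    and tau_in: "\<tau> i k \<in> V (6 * i)"
    and tau_sep: "k \<noteq> l \<Longrightarrow> j \<le> k \<Longrightarrow> j' \<le> l \<Longrightarrow> J \<subseteq> {..i} \<Longrightarrow> J' \<subseteq> {..i} \<Longrightarrow>
      \<tau> i k - \<tau> i l - (d j' - d j + (sum w J' - sum w J)) \<notin> V (6 * i + 1)"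
begin

section \<open>Convergent series with terms in the chain\<close>

definition series :: "(nat \<Rightarrow> 'a) \<Rightarrow> 'a" where
  "series a = lim (\<lambda>m. \<Sum>l<m. a l)"

text \<open>The first term lies in \<open>V (6 * i + 6)\<close> and the rest, by induction, in
  \<open>V (6 * i + 11)\<close>; so the whole segment costs one level, whatever its length.\<close>

lemma sum_segment_in_V:
  assumes "\<And>l. a l \<in> V (6 * l)"
  shows "(\<Sum>l\<in>{Suc i..<m}. a l) \<in> V (6 * i + 5)"
proof (induction "m - i" arbitrary: i)
  case 0
  then show ?case
    using V_zero by simp
next
  case (Suc n)
  show ?case
  proof (cases "Suc i < m")
    case True
    have "(\<Sum>l\<in>{Suc (Suc i)..<m}. a l) \<in> V (6 * Suc i + 5)"
      using Suc(2) by (intro Suc(1)) simp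
    moreover have "V (6 * Suc i + 5) \<subseteq> V (Suc (6 * i + 5))"
      by (intro V_antimono) simp
    moreover have "a (Suc i) \<in> V (Suc (6 * i + 5))"
      using assms[of "Suc i"] by simp
    ultimately have "a (Suc i) + (\<Sum>l\<in>{Suc (Suc i)..<m}. a l) \<in> V (6 * i + 5)"
      using V_add by blast
    then show ?thesis
      using True by (simp add: sum.atLeast_Suc_lessThan)
  qed (use V_zero in simp)
qed

lemma sum_lessThan_diff_in_V:
  assumes "\<And>l. a l \<in> V (6 * l)" "m \<ge> Suc i"
  shows "(\<Sum>l<m. a l) - (\<Sum>l\<le>i. a l) \<in> V (6 * i + 5)"
proof -
  have "(\<Sum>l<m. a l) = (\<Sum>l\<le>i. a l) + (\<Sum>l\<in>{Suc i..<m}. a l)"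
    using assms(2) by (subst sum.union_disjoint[symmetric]) (auto intro!: sum.cong)
  then show ?thesis
    using sum_segment_in_V[OF assms(1)] by simp
qed

lemma series_tendsto:
  assumes "\<And>l. a l \<in> V (6 * l)"
  shows "(\<lambda>m. \<Sum>l<m. a l) \<longlonglongrightarrow> series a"
proof -
  have "convergent (\<lambda>m. \<Sum>l<m. a l)"
  proof (rule convergentI_V)
    fix i
    have "(\<Sum>l<m. a l) - (\<Sum>l\<le>i. a l) \<in> V (Suc i)" if "m \<ge> Suc i" for m
      using sum_lessThan_diff_in_V[OF assms that] V_antimono[of "Suc i" "6 * i + 5"] by auto
    then have "(\<Sum>l<m. a l) - (\<Sum>l<n. a l) \<in> V i" if "m \<ge> Suc i" "n \<ge> Suc i" for m n
      using V_diff[of "(\<Sum>l<m. a l) - (\<Sum>l\<le>i. a l)" i "(\<Sum>l<n. a l) - (\<Sum>l\<le>i. a l)"] that by simp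
    then show "\<exists>N. \<forall>m\<ge>N. \<forall>n\<ge>N. (\<Sum>l<m. a l) - (\<Sum>l<n. a l) \<in> V i"
      by blast
  qed
  then show ?thesis
    unfolding series_def by (simp add: convergent_LIMSEQ_iff)
qed

text \<open>The limit lies in the closure of \<open>V (6 * i + 5)\<close>, which costs one more
  level.\<close>

lemma series_tail_in_V:
  assumes "\<And>l. a l \<in> V (6 * l)"
  shows "series a - (\<Sum>l\<le>i. a l) \<in> V (6 * i + 4)"
proof -
  have "series a - (\<Sum>l\<le>i. a l) \<in> closure (V (Suc (6 * i + 4)))"
  proof (rule Lim_in_closed_set[OF closed_closure])
    show "(\<lambda>m. (\<Sum>l<m. a l) - (\<Sum>l\<le>i. a l)) \<longlonglongrightarrow> series a - (\<Sum>l\<le>i. a l)"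
      by (intro tendsto_intros series_tendsto assms)
    show "\<forall>\<^sub>F m in sequentially. (\<Sum>l<m. a l) - (\<Sum>l\<le>i. a l) \<in> closure (V (Suc (6 * i + 4)))"
      unfolding eventually_sequentially
      using sum_lessThan_diff_in_V[OF assms] closure_subset
      by (metis Suc_eq_plus1 Suc_numeral add_Suc_right semiring_norm(5) subsetD)
  qed simp
  then show ?thesis
    using closure_V by blast
qed

definition t :: "(nat \<Rightarrow> nat) \<Rightarrow> 'a" where
  "t x = series (\<lambda>l. \<tau> l (x l))"

definition S :: "(nat \<Rightarrow> bool) \<Rightarrow> 'a" where
  "S e = series (\<lambda>l. if e l then w l else 0)"

text \<open>At every level finitely many closed translates cover \<open>K x\<close>, which makes it
  compact; enlarging the code only enlarges the set.\<close>

definition K :: "(nat \<Rightarrow> nat) \<Rightarrow> 'a set" where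
  "K x = {k. \<forall>i. \<exists>j\<le>x i. k - d j \<in> closure (V (6 * i + 6))}"

lemma digit_in: "(if e l then w l else 0) \<in> V (6 * l)"
  using w_in V_zero by simp

lemma S_tail:
  obtains v where "v \<in> V (6 * i + 4)" "S e = sum w {l \<in> {..i}. e l} + v"
proof
  show "S e - sum w {l \<in> {..i}. e l} \<in> V (6 * i + 4)"
    unfolding S_def using series_tail_in_V[of "\<lambda>l. if e l then w l else 0" i, OF digit_in[of e]]
    by (subst sum.inter_filter) simp_all
qed simp

lemma t_tail:
  obtains v where "v \<in> V (6 * i + 4)" "t x = (\<Sum>l<i. \<tau> l (x l)) + \<tau> i (x i) + v"
proof
  show "t x - ((\<Sum>l<i. \<tau> l (x l)) + \<tau> i (x i)) \<in> V (6 * i + 4)"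
    unfolding t_def using series_tail_in_V[of "\<lambda>l. \<tau> l (x l)" i] tau_in
    by (simp add: lessThan_Suc_atMost[symmetric])
qed simp

text \<open>At the first index \<open>i\<close> where the digits differ, the tails contribute only
  elements of \<open>V (6 * i + 4)\<close>, too little to compensate for \<open>w i\<close>.\<close>

lemma S_inj:
  assumes "S e = S e'"
  shows "e = e'"
proof (rule ccontr)
  assume "e \<noteq> e'"
  then have "\<exists>i. e i \<noteq> e' i"
    by auto
  then obtain i where i: "e i \<noteq> e' i" "\<And>l. l < i \<Longrightarrow> e l = e' l"
    using exists_least_iff[of "\<lambda>i. e i \<noteq> e' i"] by auto
  have False if "S f = S f'" "f i" "\<not> f' i" "\<And>l. l < i \<Longrightarrow> f l = f' l" for f f'
  proof -
    obtain v where v: "v \<in> V (6 * i + 4)" "S f = sum w {l \<in> {..i}. f l} + v"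
      by (rule S_tail)
    obtain v' where v': "v' \<in> V (6 * i + 4)" "S f' = sum w {l \<in> {..i}. f' l} + v'"
      by (rule S_tail)
    have "{l \<in> {..i}. f l} = insert i {l \<in> {..i}. f' l}"
      using that by (auto simp: order.order_iff_strict)
    then have "sum w {l \<in> {..i}. f l} = w i + sum w {l \<in> {..i}. f' l}"
      using that by simp
    then have "w i = v' - v"
      using v v' that(1) by (simp add: algebra_simps)
    moreover have "v' - v \<in> V (6 * i + 1)"
      by (rule V_diff_le[OF v'(1) v(1)]) simp_all
    ultimately show False
      using w_notin[of i] by auto
  qed
  then show False
    using i assms by metis
qed

text \<open>The quantitative form serves twice. For difference \<open>0\<close> it says that a
  translate of the Cantor set meets only one \<open>t x + K x\<close>; for equal \<open>e\<close>
  and \<open>e'\<close> it says that nearby points have codes with a long common initial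
  segment.\<close>

lemma separation:
  assumes agree: "\<And>l. l < i \<Longrightarrow> x l = x' l" and neq: "x i \<noteq> x' i"
    and y: "y - t x \<in> K x" and y': "y' - t x' \<in> K x'"
  shows "(y + S e) - (y' + S e') \<notin> V (6 * i + 6)"
proof
  assume u: "(y + S e) - (y' + S e') \<in> V (6 * i + 6)"
  obtain j where j: "j \<le> x i" "y - t x - d j \<in> V (6 * i + 5)"
    using y closure_V[of "6 * i + 5"] unfolding K_def by (auto simp: eval_nat_numeral)
  obtain j' where j': "j' \<le> x' i" "y' - t x' - d j' \<in> V (6 * i + 5)"
    using y' closure_V[of "6 * i + 5"] unfolding K_def by (auto simp: eval_nat_numeral)
  obtain p where p: "p \<in> V (6 * i + 4)" "t x = (\<Sum>l<i. \<tau> l (x l)) + \<tau> i (x i) + p"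
    by (rule t_tail)
  obtain p' where p': "p' \<in> V (6 * i + 4)" "t x' = (\<Sum>l<i. \<tau> l (x' l)) + \<tau> i (x' i) + p'"
    by (rule t_tail)
  obtain q where q: "q \<in> V (6 * i + 4)" "S e = sum w {l \<in> {..i}. e l} + q"
    by (rule S_tail)
  obtain q' where q': "q' \<in> V (6 * i + 4)" "S e' = sum w {l \<in> {..i}. e' l} + q'"
    by (rule S_tail)
  have agree_sum: "(\<Sum>l<i. \<tau> l (x' l)) = (\<Sum>l<i. \<tau> l (x l))"
    using agree by (intro sum.cong) auto
  let ?k = "(y' - t x' - d j') - (y - t x - d j)"
  let ?u = "(y + S e) - (y' + S e')"
  have "?k \<in> V (6 * i + 4)"
    by (rule V_diff_le[OF j'(2) j(2)]) simp_all
  then have "?k + ?u \<in> V (6 * i + 3)"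
    by (rule V_add_le[OF _ u]) simp_all
  moreover have "p' - p \<in> V (6 * i + 3)" "q' - q \<in> V (6 * i + 3)"
    by (rule V_diff_le[OF p'(1) p(1)] V_diff_le[OF q'(1) q(1)]; simp)+
  then have "(p' - p) + (q' - q) \<in> V (6 * i + 2)"
    by (rule V_add_le) simp_all
  ultimately have "(?k + ?u) + ((p' - p) + (q' - q)) \<in> V (6 * i + 1)"
    by (rule V_add_le) simp_all
  \<comment> \<open>With all error terms collected, the sums below \<open>i\<close> cancel by
    \<open>agree_sum\<close>, and exactly the expression excluded by \<open>tau_sep\<close>
    remains.\<close>
  moreover have "(?k + ?u) + ((p' - p) + (q' - q)) = \<tau> i (x i) - \<tau> i (x' i) -
      (d j' - d j + (sum w {l \<in> {..i}. e' l} - sum w {l \<in> {..i}. e l}))"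
    unfolding p(2) p'(2) q(2) q'(2) agree_sum by (simp add: algebra_simps)
  moreover have "\<tau> i (x i) - \<tau> i (x' i) -
      (d j' - d j + (sum w {l \<in> {..i}. e' l} - sum w {l \<in> {..i}. e l})) \<notin> V (6 * i + 1)"
    by (rule tau_sep[OF neq j(1) j'(1)]) auto
  ultimately show False
    by metis
qed

section \<open>Limits of points whose codes converge coordinatewise\<close>

lemma K_closed_limit:
  assumes "\<And>m. k m \<in> K (X m)" "k \<longlonglongrightarrow> l"
    and X: "\<And>i. eventually (\<lambda>m. X m i = x i) sequentially"
  shows "l \<in> K x"
  unfolding K_def
proof (intro CollectI allI)
  fix i
  \<comment> \<open>Only coordinate \<open>i\<close> of the code matters at level \<open>i\<close>,
    and it is eventually \<open>x i\<close>; so the points eventually lie in one closed set.\<close>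
  let ?C = "\<Union>j\<le>x i. {c. c - d j \<in> closure (V (6 * i + 6))}"
  have "closed {c. c - d j \<in> closure (V (6 * i + 6))}" for j
    using closed_vimage[of "closure (V (6 * i + 6))" "\<lambda>c. c - d j"]
    by (simp add: vimage_def continuous_on_diff)
  then have "closed ?C"
    by (intro closed_UN) auto
  moreover have "eventually (\<lambda>m. k m \<in> ?C) sequentially"
    using X[of i]
  proof eventually_elim
    case (elim m)
    then show ?case
      using assms(1)[of m] unfolding K_def by force
  qed
  ultimately have "l \<in> ?C"
    using assms(2) by (intro Lim_in_closed_set) auto
  then show "\<exists>j\<le>x i. l - d j \<in> closure (V (6 * i + 6))"
    by auto
qed

lemma K_convergent_subseq:
  assumes "\<And>m. k m \<in> K (X m)"
    and X: "\<And>i. eventually (\<lambda>m. X m i = x i) sequentially"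
  obtains r l where "strict_mono (r :: nat \<Rightarrow> nat)" "(k \<circ> r) \<longlonglongrightarrow> l" "l \<in> K x"
proof -
  have "\<exists>D. finite D \<and> eventually (\<lambda>m. \<exists>a\<in>D. k m - a \<in> V i) sequentially" for i
  proof (intro exI[of _ "d ` {..x i}"] conjI)
    show "eventually (\<lambda>m. \<exists>a\<in>d ` {..x i}. k m - a \<in> V i) sequentially"
      using X[of i]
    proof eventually_elim
      case (elim m)
      have "\<exists>j\<le>X m i. k m - d j \<in> closure (V (6 * i + 6))"
        using assms(1)[of m] unfolding K_def by simp
      then obtain j where "j \<le> x i" "k m - d j \<in> closure (V (6 * i + 6))"
        unfolding elim by blast
      moreover have "closure (V (Suc (6 * i + 5))) \<subseteq> V i"
        using closure_V V_antimono[of i "6 * i + 5"] by (rule order_trans) simp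
      then have "closure (V (6 * i + 6)) \<subseteq> V i"
        by (simp add: add.commute)
      ultimately show ?case
        by blast
    qed
  qed simp
  then obtain r l where r: "strict_mono (r :: nat \<Rightarrow> nat)" "(k \<circ> r) \<longlonglongrightarrow> l"
    using totally_bounded_convergent_subseq by blast
  have "l \<in> K x"
  proof (rule K_closed_limit)
    show "(k \<circ> r) m \<in> K (X (r m))" for m
      using assms(1) by simp
    show "eventually (\<lambda>m. X (r m) i = x i) sequentially" for i
      using eventually_compose_filterlim[OF X filterlim_subseq[OF r(1)]] .
  qed fact
  with r show thesis
    by (rule that)
qed

lemma t_continuous:
  assumes X: "\<And>i. eventually (\<lambda>m. X m i = x i) sequentially"
  shows "(\<lambda>m. t (X m)) \<longlonglongrightarrow> t x"
proof (rule tendstoI_V)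
  fix i
  have "eventually (\<lambda>m. \<forall>l\<in>{..i}. X m l = x l) sequentially"
    using X by (simp add: eventually_ball_finite)
  then show "eventually (\<lambda>m. t (X m) - t x \<in> V i) sequentially"
  proof eventually_elim
    case (elim m)
    obtain p where p: "p \<in> V (6 * i + 4)"
        "t (X m) = (\<Sum>l<i. \<tau> l (X m l)) + \<tau> i (X m i) + p"
      by (rule t_tail)
    obtain p' where p': "p' \<in> V (6 * i + 4)" "t x = (\<Sum>l<i. \<tau> l (x l)) + \<tau> i (x i) + p'"
      by (rule t_tail)
    have "(\<Sum>l<i. \<tau> l (X m l)) = (\<Sum>l<i. \<tau> l (x l))"
      using elim by (intro sum.cong) auto
    then have "t (X m) - t x = p - p'"
      using p p' elim by simp
    moreover have "p - p' \<in> V i"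
      by (rule V_diff_le[OF p(1) p'(1)]) simp_all
    ultimately show ?case
      by simp
  qed
qed

text \<open>By \<open>separation\<close>, convergence of \<open>y\<close> forces every coordinate of
  the codes to become constant; then the points \<open>y'\<close> of the same translates have a
  convergent subsequence.\<close>

lemma fibre_limit:
  assumes y: "\<And>m. y m - t (X m) \<in> K (X m)" and y': "\<And>m. y' m - t (X m) \<in> K (X m)"
    and lim: "y \<longlonglongrightarrow> l"
  obtains x r l' where "\<And>i. eventually (\<lambda>m. X m i = x i) sequentially"
    "strict_mono (r :: nat \<Rightarrow> nat)" "(y' \<circ> r) \<longlonglongrightarrow> l'" "l - t x \<in> K x" "l' - t x \<in> K x"
proof -
  have "\<exists>c. eventually (\<lambda>m. X m i = c) sequentially" for i
  proof -
    obtain N where N: "\<And>m. m \<ge> N \<Longrightarrow> y m - l \<in> V (Suc (6 * i + 6))"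
      using tendstoD_V[OF lim] unfolding eventually_sequentially by meson
    have "X m i = X N i" if m: "m \<ge> N" for m
    proof (rule ccontr)
      assume "X m i \<noteq> X N i"
      \<comment> \<open>\<open>separation\<close> needs agreement below the index, so the least
        disagreement \<open>a\<close> is taken; since \<open>a \<le> i\<close>, closeness at level
        \<open>6 * i + 6\<close> is enough.\<close>
      then obtain a where a: "X m a \<noteq> X N a" "\<And>b. b < a \<Longrightarrow> X m b = X N b" "a \<le> i"
        using exists_least_iff[of "\<lambda>i. X m i \<noteq> X N i"] by (metis not_le)
      have "y m - y N \<in> V (6 * i + 6)"
        using V_diff[OF N[OF m] N[OF order_refl]] by simp
      moreover have "V (6 * i + 6) \<subseteq> V (6 * a + 6)"
        using a(3) by (intro V_antimono) simp
      ultimately show False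
        using separation[OF a(2,1) y y, of "\<lambda>_. False" "\<lambda>_. False"] by auto
    qed
    then show ?thesis
      unfolding eventually_sequentially by blast
  qed
  then obtain x where x: "\<And>i. eventually (\<lambda>m. X m i = x i) sequentially"
    by metis
  obtain r k' where r: "strict_mono (r :: nat \<Rightarrow> nat)"
      "((\<lambda>m. y' m - t (X m)) \<circ> r) \<longlonglongrightarrow> k'" "k' \<in> K x"
    using K_convergent_subseq[OF y' x] by metis
  have "(\<lambda>m. t (X (r m))) \<longlonglongrightarrow> t x"
    using LIMSEQ_subseq_LIMSEQ[OF t_continuous[OF x] r(1)] by (simp add: o_def)
  then have "(\<lambda>m. (y' (r m) - t (X (r m))) + t (X (r m))) \<longlonglongrightarrow> k' + t x"
    using r(2) by (intro tendsto_intros) (auto simp: o_def)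
  moreover have "l - t x \<in> K x"
    using y tendsto_diff[OF lim t_continuous[OF x]] x by (rule K_closed_limit)
  ultimately show thesis
    using that[OF x r(1), of "k' + t x"] r(3) by (simp add: o_def)
qed

lemma compact_K: "compact (K x)"
  unfolding compact_eq_seq_compact_metric
proof (rule seq_compactI)
  fix f :: "nat \<Rightarrow> 'a" assume "\<forall>n. f n \<in> K x"
  then show "\<exists>l\<in>K x. \<exists>r. strict_mono r \<and> (f \<circ> r) \<longlonglongrightarrow> l"
    using K_convergent_subseq[of f "\<lambda>_. x" x] by auto metis
qed

text \<open>Density of \<open>d\<close> and compactness give finitely many translates at each level.
  Any larger code works as well, which leaves room for further information in it.\<close>

lemma compact_subset_K:
  assumes "compact C"
  shows "\<exists>b. \<forall>x. (\<forall>i. b i \<le> x i) \<longrightarrow> C \<subseteq> K x"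
proof -
  have "\<exists>b. \<forall>c\<in>C. \<exists>j\<le>b. c - d j \<in> V (6 * i + 6)" for i
  proof -
    let ?O = "\<lambda>j. {c. c - d j \<in> V (6 * i + 6)}"
    have "C \<subseteq> (\<Union>j. ?O j)"
    proof
      fix c
      have "open {v. c - v \<in> V (6 * i + 6)}" "c \<in> {v. c - v \<in> V (6 * i + 6)}"
        using V_open V_zero open_translate_vimage(3) by auto
      then show "c \<in> (\<Union>j. ?O j)"
        using d_dense by blast
    qed
    then obtain J where J: "finite J" "C \<subseteq> (\<Union>j\<in>J. ?O j)"
      using compactE_image[OF assms, of UNIV ?O] V_open open_translate_vimage(2) by metis
    have "\<exists>j\<le>Max J. c - d j \<in> V (6 * i + 6)" if "c \<in> C" for c
      using J that Max_ge by blast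
    then show ?thesis
      by blast
  qed
  then obtain b where b: "\<And>i c. c \<in> C \<Longrightarrow> \<exists>j\<le>b i. c - d j \<in> V (6 * i + 6)"
    by metis
  have "C \<subseteq> K x" if "\<forall>i. b i \<le> x i" for x
    using b that closure_subset unfolding K_def by (blast intro: order_trans)
  then show ?thesis
    by blast
qed

end

text \<open>Each vector is chosen outside finitely many translates of \<open>V (6 * i + 1)\<close>,
  which never cover \<open>V (6 * i)\<close>.\<close>

lemma ex_compact_coding:
  assumes "\<not> locally_compact_space (euclidean :: 'a::{topological_ab_group_add, polish_space} topology)"
  shows "\<exists>V d (w :: nat \<Rightarrow> 'a) \<tau>. compact_coding V d w \<tau>"
proof -
  obtain V :: "nat \<Rightarrow> 'a set" where "nhd_chain V" and
      NC: "\<And>i D. finite D \<Longrightarrow> \<exists>v\<in>V i. \<forall>d\<in>D. v - d \<notin> V (Suc i)"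
    using ex_noncovering_nhd_chain[OF assms] by metis
  then interpret nhd_chain V by simp
  obtain D :: "'a set" where D: "countable D" "\<And>X. open X \<Longrightarrow> X \<noteq> {} \<Longrightarrow> \<exists>d\<in>D. d \<in> X"
    by (rule countable_dense_setE) blast
  define d where "d = from_nat_into D"
  have "D \<noteq> {}"
    using D(2)[of UNIV] by auto
  then have d: "\<exists>j. d j \<in> U" if "open U" "U \<noteq> {}" for U
    using D that range_from_nat_into[of D] unfolding d_def by (metis rangeE)
  have "\<exists>v\<in>V (6 * i). v \<notin> V (6 * i + 1)" for i
    using NC[of "{0}" "6 * i"] by auto
  then obtain w where w: "\<And>i. w i \<in> V (6 * i)" "\<And>i. w i \<notin> V (6 * i + 1)"
    by metis
  \<comment> \<open>These are the corrections in \<open>tau_sep\<close> with indices at most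
    \<open>k\<close>. The set is finite, so recursion on \<open>k\<close> can choose
    \<open>\<tau> i k\<close> to avoid them around every earlier \<open>\<tau> i l\<close>.\<close>
  define E where "E i k = (\<lambda>(j, j', J, J'). d j' - d j + (sum w J' - sum w J)) `
    ({..k} \<times> {..k} \<times> Pow {..i} \<times> Pow {..i})" for i k :: nat
  have E_finite: "finite (E i k)" for i k
    unfolding E_def by auto
  have E_in: "d j' - d j + (sum w J' - sum w J) \<in> E i k"
    if "j \<le> k" "j' \<le> k" "J \<subseteq> {..i}" "J' \<subseteq> {..i}" for i j j' k J J'
    unfolding E_def using that by (intro image_eqI[of _ _ "(j, j', J, J')"]) auto
  have "\<exists>f. \<forall>k. f k \<in> V (6 * i) \<and> (\<forall>l<k. \<forall>e\<in>E i k. f k - f l - e \<notin> V (6 * i + 1))" for i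
  proof (rule dependent_wf_choice[of less_than])
    fix k and f :: "nat \<Rightarrow> 'a"
    let ?D = "(\<lambda>(l, e). f l + e) ` ({..<k} \<times> E i k)"
    have "finite ?D"
      using E_finite by auto
    then obtain v where v: "v \<in> V (6 * i)" "\<And>a. a \<in> ?D \<Longrightarrow> v - a \<notin> V (Suc (6 * i))"
      using NC by metis
    have "v - f l - e \<notin> V (6 * i + 1)" if "l < k" "e \<in> E i k" for l e
    proof -
      have "f l + e \<in> ?D"
        using that by (intro image_eqI[of _ _ "(l, e)"]) auto
      then show ?thesis
        using v(2) by (fastforce simp: diff_diff_eq)
    qed
    with v(1) show "\<exists>r. r \<in> V (6 * i) \<and> (\<forall>l<k. \<forall>e\<in>E i k. r - f l - e \<notin> V (6 * i + 1))"
      by blast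
  qed auto
  then obtain \<tau> where tau: "\<And>i k. \<tau> i k \<in> V (6 * i)"
      "\<And>i k l e. l < k \<Longrightarrow> e \<in> E i k \<Longrightarrow> \<tau> i k - \<tau> i l - e \<notin> V (6 * i + 1)"
    by metis
  have "compact_coding V d w \<tau>"
  proof
    fix k l j j' i :: nat and J J' :: "nat set"
    assume *: "k \<noteq> l" "j \<le> k" "j' \<le> l" "J \<subseteq> {..i}" "J' \<subseteq> {..i}"
    show "\<tau> i k - \<tau> i l - (d j' - d j + (sum w J' - sum w J)) \<notin> V (6 * i + 1)"
    proof (cases "l < k")
      case True
      then show ?thesis
        using * by (intro tau(2) E_in) auto
    next
      case False
      \<comment> \<open>This is the case \<open>k < l\<close> with the roles exchanged; symmetry of
        the neighbourhoods carries it back.\<close>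
      then have "\<tau> i l - \<tau> i k - (d j - d j' + (sum w J - sum w J')) \<notin> V (6 * i + 1)"
        using * by (intro tau(2) E_in) auto
      then show ?thesis
        using V_minus by (metis (no_types, lifting) add_diff_eq diff_add_eq diff_diff_eq2 minus_diff_eq)
    qed
  qed (use d w tau(1) in auto)
  then show ?thesis
    by blast
qed

section \<open>Borel selection of one point in each fibre\<close>

text \<open>The sublevel sets at the values taken on \<open>C\<close> have the finite intersection
  property within \<open>C\<close>; a common point in \<open>C\<close> is a minimiser.\<close>

lemma closed_sublevels_attain_min:
  fixes f :: "'a::t2_space \<Rightarrow> real"
  assumes "compact C" "C \<noteq> {}" and closed: "\<And>q. closed {y. f y \<le> q}"
  shows "\<exists>y\<in>C. \<forall>z\<in>C. f y \<le> f z"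
proof -
  let ?F = "(\<lambda>z. {y. f y \<le> f z}) ` C"
  have "C \<inter> \<Inter>?F \<noteq> {}"
  proof (rule compact_imp_fip[OF \<open>compact C\<close>])
    fix F' assume "finite F'" "F' \<subseteq> ?F"
    then obtain Z where Z: "finite Z" "Z \<subseteq> C" "F' = (\<lambda>z. {y. f y \<le> f z}) ` Z"
      by (meson finite_subset_image)
    show "C \<inter> \<Inter>F' \<noteq> {}"
    proof (cases "Z = {}")
      case False
      then obtain z where "z \<in> Z" "\<And>z'. z' \<in> Z \<Longrightarrow> f z \<le> f z'"
        using ex_is_arg_min_if_finite[OF Z(1), of f] by (auto simp: is_arg_min_linorder)
      then show ?thesis
        using Z by auto
    qed (use Z \<open>C \<noteq> {}\<close> in simp)
  qed (use closed in auto)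
  then show ?thesis
    by auto
qed

text \<open>
  Applied to membership in the sets of a countable base, this gives an injective function that
  is lower semicontinuous, so every nonempty compact set has a unique point minimising it.
\<close>

definition ternary :: "(nat \<Rightarrow> bool) \<Rightarrow> real" where
  "ternary b = (\<Sum>j. of_bool (b j) * (1 / 3) ^ j)"

lemma summable_ternary: "summable (\<lambda>j. of_bool (b j) * (1 / 3 :: real) ^ j)"
  by (rule summable_comparison_test'[OF summable_geometric[of "1 / 3 :: real"]]) auto

text \<open>In base three with digits \<open>0\<close> and \<open>1\<close>, all positions after
  \<open>j\<close> together contribute at most half of a digit at \<open>j\<close>. In base two the
  value would not determine the sequence.\<close>

lemma ternary_less:
  assumes "\<And>i. i < j \<Longrightarrow> b i = b' i" "\<not> b j" "b' j"
  shows "ternary b < ternary b'"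
proof -
  let ?f = "\<lambda>b j. of_bool (b j) * (1 / 3 :: real) ^ j"
  have "(\<Sum>i. ?f b (i + Suc j)) \<le> (\<Sum>i. (1 / 3) ^ Suc j * (1 / 3) ^ i)"
    by (intro suminf_le summable_mult summable_geometric summable_ignore_initial_segment
        summable_ternary) (auto simp: power_add)
  also have "\<dots> = (1 / 3) ^ j / 2"
    by (subst suminf_mult) (auto simp: suminf_geometric intro!: summable_geometric)
  finally have tail: "(\<Sum>i. ?f b (i + Suc j)) \<le> (1 / 3) ^ j / 2" .
  have "ternary b = (\<Sum>i. ?f b (i + Suc j)) + (\<Sum>i<Suc j. ?f b i)"
    unfolding ternary_def by (rule suminf_split_initial_segment[OF summable_ternary])
  also have "\<dots> \<le> (1 / 3) ^ j / 2 + (\<Sum>i<j. ?f b i)"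
    using tail assms(2) by simp
  also have "(\<Sum>i<j. ?f b i) = (\<Sum>i<j. ?f b' i)"
    using assms(1) by (intro sum.cong) auto
  also have "(1 / 3) ^ j / 2 + (\<Sum>i<j. ?f b' i) < (\<Sum>i<Suc j. ?f b' i)"
    using assms(3) by simp
  also have "\<dots> \<le> ternary b'"
    unfolding ternary_def by (intro sum_le_suminf summable_ternary) auto
  finally show ?thesis .
qed

lemma ternary_inj:
  assumes "ternary b = ternary b'"
  shows "b = b'"
proof (rule ccontr)
  assume "b \<noteq> b'"
  then have "\<exists>j. b j \<noteq> b' j"
    by auto
  then obtain j where "b j \<noteq> b' j" "\<And>i. i < j \<Longrightarrow> b i = b' i"
    using exists_least_iff[of "\<lambda>j. b j \<noteq> b' j"] by auto
  then show False
    using assms ternary_less[of j b b'] ternary_less[of j b' b] by (cases "b j") auto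
qed

text \<open>A value above \<open>q\<close> is witnessed by finitely many digits equal to
  \<open>1\<close>, and these persist on a finite intersection of sets \<open>b j\<close>.\<close>

lemma closed_ternary_sublevel:
  assumes "\<And>j. open (b j)"
  shows "closed {y. ternary (\<lambda>j. y \<in> b j) \<le> q}"
proof -
  let ?f = "\<lambda>y j. of_bool (y \<in> b j) * (1 / 3 :: real) ^ j"
  have "open {y. ternary (\<lambda>j. y \<in> b j) > q}"
    unfolding open_subopen[of "{y. ternary (\<lambda>j. y \<in> b j) > q}"]
  proof
    fix y assume "y \<in> {y. ternary (\<lambda>j. y \<in> b j) > q}"
    then have "q < ternary (\<lambda>j. y \<in> b j)"
      by simp
    moreover have "(\<lambda>n. \<Sum>j<n. ?f y j) \<longlonglongrightarrow> ternary (\<lambda>j. y \<in> b j)"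
      unfolding ternary_def by (rule summable_LIMSEQ[OF summable_ternary])
    ultimately obtain n where n: "q < (\<Sum>j<n. ?f y j)"
      using order_tendstoD(1) eventually_sequentially by (metis (no_types, lifting) order_refl)
    let ?T = "\<Inter>j\<in>{j. j < n \<and> y \<in> b j}. b j"
    have "q < ternary (\<lambda>j. z \<in> b j)" if z: "z \<in> ?T" for z
    proof -
      note n
      also have "(\<Sum>j<n. ?f y j) \<le> (\<Sum>j<n. ?f z j)"
        using z by (intro sum_mono) auto
      also have "\<dots> \<le> ternary (\<lambda>j. z \<in> b j)"
        unfolding ternary_def by (intro sum_le_suminf summable_ternary) auto
      finally show ?thesis .
    qed
    moreover have "open ?T"
      using assms by (intro open_INT) auto
    ultimately show "\<exists>T. open T \<and> y \<in> T \<and> T \<subseteq> {y. ternary (\<lambda>j. y \<in> b j) > q}"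
      by (intro exI[of _ ?T]) auto
  qed
  moreover have "{y. ternary (\<lambda>j. y \<in> b j) \<le> q} = - {y. ternary (\<lambda>j. y \<in> b j) > q}"
    by auto
  ultimately show ?thesis
    by (simp add: closed_Compl)
qed

section \<open>The coin-tossing measure\<close>

abbreviation coin :: "(nat \<Rightarrow> bool) measure" where
  "coin \<equiv> PiM UNIV (\<lambda>_. measure_pmf (bernoulli_pmf (1 / 2)))"

lemma coin_prob_space: "prob_space coin"
  by (intro prob_space_PiM measure_pmf.prob_space_axioms)

text \<open>The first \<open>n\<close> coordinates of \<open>e\<close> define a cylinder of measure
  \<open>(1 / 2) ^ n\<close> that contains \<open>A\<close>.\<close>

lemma coin_subset_singleton_null:
  assumes "A \<subseteq> {e}"
  shows "emeasure coin A = 0"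
proof -
  let ?M = "\<lambda>_ :: nat. measure_pmf (bernoulli_pmf (1 / 2))"
  have "emeasure coin A \<le> (1 / 2) ^ n" for n
  proof -
    let ?C = "prod_emb UNIV ?M {..<n} (PiE {..<n} (\<lambda>i. {e i}))"
    have "emeasure coin A \<le> emeasure coin ?C"
      using assms by (intro emeasure_mono sets_PiM_I) (auto simp: prod_emb_def)
    also have "\<dots> = (\<Prod>i<n. emeasure (?M i) {e i})"
      by (intro emeasure_PiM_emb) (auto intro: measure_pmf.prob_space_axioms)
    also have "\<dots> = (\<Prod>i<n. 1 / 2)"
      by (intro prod.cong) (auto simp: emeasure_pmf_single divide_ennreal[symmetric] divide_ennreal_def)
    finally show ?thesis
      by simp
  qed
  moreover have "(\<lambda>n. (1 / 2 :: ennreal) ^ n) \<longlonglongrightarrow> 0"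
  proof -
    have "(\<lambda>n. ennreal ((1 / 2) ^ n)) \<longlonglongrightarrow> ennreal 0"
      by (intro tendsto_ennrealI LIMSEQ_power_zero) simp
    moreover have "ennreal ((1 / 2) ^ n) = (1 / 2) ^ n" for n
      by (simp add: ennreal_power[symmetric] divide_ennreal[symmetric] divide_ennreal_def)
    ultimately show ?thesis
      by simp
  qed
  ultimately have "emeasure coin A \<le> 0"
    by (meson LIMSEQ_le_const)
  then show ?thesis
    by simp
qed

section \<open>Codes of open sets and the selected points\<close>

locale hull_coding = compact_coding V d w \<tau>
  for V :: "nat \<Rightarrow> 'a::{topological_ab_group_add, polish_space} set" and d w \<tau> +
  fixes b :: "nat \<Rightarrow> 'a set"
  assumes b_open: "open (b j)"
    and b_base: "open O' \<Longrightarrow> a \<in> O' \<Longrightarrow> \<exists>j. a \<in> b j \<and> b j \<subseteq> O'"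
begin

text \<open>
  A code \<open>x\<close> describes a compact set by its size and a sequence of open sets by its parities.
\<close>

definition U :: "nat \<Rightarrow> (nat \<Rightarrow> nat) \<Rightarrow> 'a set" where
  "U n x = (\<Union>j\<in>{j. odd (x (prod_encode (n, j)))}. b j)"

definition fibre :: "nat \<Rightarrow> (nat \<Rightarrow> nat) \<Rightarrow> 'a set" where
  "fibre n x = {y. y - t x \<in> K x \<and> y \<notin> U n x}"

definition weight :: "'a \<Rightarrow> real" where
  "weight y = ternary (\<lambda>j. y \<in> b j)"

definition B :: "nat \<Rightarrow> 'a set" where
  "B n = {y. \<exists>x. y \<in> fibre n x \<and> (\<forall>z\<in>fibre n x. weight y \<le> weight z)}"

lemma weight_inj:
  assumes "weight y = weight z"
  shows "y = z"
proof (rule ccontr)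
  assume "y \<noteq> z"
  moreover have "y \<in> b j \<longleftrightarrow> z \<in> b j" for j
    using ternary_inj assms unfolding weight_def by metis
  ultimately show False
    using b_base[of "- {z}" y] by auto
qed

lemma ex_code:
  assumes "compact C" "\<And>n. open (O' n)"
  shows "\<exists>x. C \<subseteq> K x \<and> (\<forall>n. U n x = O' n)"
proof -
  obtain c where c: "\<And>x. (\<forall>i. c i \<le> x i) \<Longrightarrow> C \<subseteq> K x"
    using compact_subset_K[OF assms(1)] by blast
  \<comment> \<open>Doubling keeps the code above \<open>c i\<close> and frees the parity, which at
    \<open>prod_encode (n, j)\<close> records whether \<open>b j\<close> is part of
    \<open>O' n\<close>.\<close>
  define x where "x i = 2 * c i + (case prod_decode i of (n, j) \<Rightarrow> of_bool (b j \<subseteq> O' n))" for i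
  have "odd (x (prod_encode (n, j))) \<longleftrightarrow> b j \<subseteq> O' n" for n j
    by (simp add: x_def)
  then have U: "U n x = (\<Union>j\<in>{j. b j \<subseteq> O' n}. b j)" for n
    by (simp add: U_def)
  have "U n x = O' n" for n
    unfolding U
  proof (intro equalityI subsetI)
    fix a assume "a \<in> O' n"
    then obtain j where "a \<in> b j" "b j \<subseteq> O' n"
      using b_base[OF assms(2)] by metis
    then show "a \<in> (\<Union>j\<in>{j. b j \<subseteq> O' n}. b j)"
      by auto
  qed auto
  moreover have "C \<subseteq> K x"
    by (rule c) (simp add: x_def)
  ultimately show ?thesis
    by blast
qed

lemma open_U: "open (U n x)"
  unfolding U_def using b_open by blast

text \<open>This is \<open>separation\<close> for difference \<open>0\<close>, taken at the first
  index where the codes differ. For \<open>e = e'\<close> it says that a point determines its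
  code.\<close>

lemma fibre_unique:
  assumes "y - t x \<in> K x" "y' - t x' \<in> K x'" "y + S e = y' + S e'"
  shows "x = x'"
proof (rule ccontr)
  assume "x \<noteq> x'"
  then have "\<exists>i. x i \<noteq> x' i"
    by auto
  then obtain i where "x i \<noteq> x' i" "\<And>l. l < i \<Longrightarrow> x l = x' l"
    using exists_least_iff[of "\<lambda>i. x i \<noteq> x' i"] by auto
  then show False
    using separation[of i x x' y y' e e'] assms V_zero by simp
qed

text \<open>Membership of \<open>l\<close> in \<open>U n x\<close> is due to one odd coordinate and
  one open set; both would be shared by almost all members of the sequence.\<close>

lemma U_limit:
  assumes "\<And>m. z m \<notin> U n (X m)" "z \<longlonglongrightarrow> l"
    and X: "\<And>i. eventually (\<lambda>m. X m i = x i) sequentially"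
  shows "l \<notin> U n x"
proof
  assume "l \<in> U n x"
  then obtain j where j: "odd (x (prod_encode (n, j)))" "l \<in> b j"
    by (auto simp: U_def)
  have "eventually (\<lambda>m. z m \<in> b j) sequentially"
    using topological_tendstoD[OF assms(2) b_open j(2)] .
  then have "eventually (\<lambda>m. False) sequentially"
    using X[of "prod_encode (n, j)"]
  proof eventually_elim
    case (elim m)
    then show ?case
      using assms(1)[of m] j(1) unfolding U_def by (metis (mono_tags, lifting) UN_I mem_Collect_eq)
  qed
  then show False
    by simp
qed

text \<open>
  The map sending a point of the union of all \<open>t x + K x\<close> to its code \<open>x\<close> is perfect,
  so saturations of closed sets are closed.
\<close>

lemma closed_saturation:
  assumes "closed Q"
  shows "closed {y. \<exists>x. y - t x \<in> K x \<and> (\<exists>z\<in>fibre n x. z \<in> Q)}"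
  unfolding closed_sequential_limits
proof (intro allI impI)
  fix y l
  assume "(\<forall>m. y m \<in> {y. \<exists>x. y - t x \<in> K x \<and> (\<exists>z\<in>fibre n x. z \<in> Q)}) \<and> y \<longlonglongrightarrow> l"
  then have "\<forall>m. \<exists>x z. y m - t x \<in> K x \<and> z \<in> fibre n x \<and> z \<in> Q" and lim: "y \<longlonglongrightarrow> l"
    by blast+
  then obtain X z where X: "\<And>m. y m - t (X m) \<in> K (X m)" and
      z: "\<And>m. z m \<in> fibre n (X m)" "\<And>m. z m \<in> Q"
    by metis
  have z': "z m - t (X m) \<in> K (X m)" for m
    using z by (simp add: fibre_def)
  obtain x r l' where x: "\<And>i. eventually (\<lambda>m. X m i = x i) sequentially"
    and r: "strict_mono (r :: nat \<Rightarrow> nat)" "(z \<circ> r) \<longlonglongrightarrow> l'"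
    and l: "l - t x \<in> K x" "l' - t x \<in> K x"
    using fibre_limit[OF X z' lim] by blast
  have "l' \<notin> U n x"
  proof (rule U_limit)
    show "(z \<circ> r) m \<notin> U n (X (r m))" for m
      using z by (simp add: fibre_def)
    show "eventually (\<lambda>m. X (r m) i = x i) sequentially" for i
      using eventually_compose_filterlim[OF x filterlim_subseq[OF r(1)]] .
  qed fact
  moreover have "l' \<in> Q"
    using z(2) by (intro closed_sequentially[OF assms _ r(2)]) simp
  ultimately show "l \<in> {y. \<exists>x. y - t x \<in> K x \<and> (\<exists>z\<in>fibre n x. z \<in> Q)}"
    using l by (auto simp: fibre_def)
qed

lemma closed_fibres: "closed (\<Union>x. fibre n x)"
  unfolding closed_sequential_limits
proof (intro allI impI)
  fix y l
  assume "(\<forall>m. y m \<in> (\<Union>x. fibre n x)) \<and> y \<longlonglongrightarrow> l"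
  then have "\<forall>m. \<exists>x. y m \<in> fibre n x" and lim: "y \<longlonglongrightarrow> l"
    by blast+
  then obtain X where X: "\<And>m. y m \<in> fibre n (X m)"
    by metis
  have y: "y m - t (X m) \<in> K (X m)" for m
    using X by (simp add: fibre_def)
  obtain x where x: "\<And>i. eventually (\<lambda>m. X m i = x i) sequentially" and l: "l - t x \<in> K x"
    using fibre_limit[OF y y lim] by blast
  have "l \<notin> U n x"
    using _ lim x by (rule U_limit) (use X in \<open>simp add: fibre_def\<close>)
  then show "l \<in> (\<Union>x. fibre n x)"
    using l by (auto simp: fibre_def)
qed

lemma closed_weight_sublevel: "closed {y. weight y \<le> q}"
  unfolding weight_def using b_open by (rule closed_ternary_sublevel)

text \<open>Minimality quantifies over all points of a fibre; rational thresholds \<open>q\<close>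
  reduce it to countably many closed sets.\<close>

lemma B_borel: "B n \<in> sets borel"
proof -
  let ?Z = "\<lambda>q. {y. \<exists>x. y - t x \<in> K x \<and> (\<exists>z\<in>fibre n x. z \<in> {z. weight z \<le> q})}"
  have "B n = (\<Union>x. fibre n x) - (\<Union>q\<in>\<rat>. ?Z q - {y. weight y \<le> q})" (is "_ = ?R")
  proof (intro equalityI subsetI)
    fix y assume "y \<in> B n"
    then obtain x where x: "y \<in> fibre n x" "\<And>z. z \<in> fibre n x \<Longrightarrow> weight y \<le> weight z"
      by (auto simp: B_def)
    \<comment> \<open>Since the code of \<open>y\<close> is unique, every witness of
      \<open>y \<in> ?Z q\<close> comes from the fibre in which \<open>y\<close> is minimal.\<close>
    have unique: "x' = x" if "y - t x' \<in> K x'" for x'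
      using fibre_unique[of y x' y x] x(1) that by (simp add: fibre_def)
    have "weight y \<le> q" if "y \<in> ?Z q" for q
    proof -
      from that obtain x' z where z: "y - t x' \<in> K x'" "z \<in> fibre n x'" "weight z \<le> q"
        by blast
      then have "weight y \<le> weight z"
        using unique x(2) by simp
      with z(3) show ?thesis
        by simp
    qed
    with x(1) show "y \<in> ?R"
      by blast
  next
    fix y assume y: "y \<in> ?R"
    then obtain x where x: "y \<in> fibre n x"
      by blast
    have "weight y \<le> weight z" if z: "z \<in> fibre n x" for z
    proof (rule ccontr)
      assume "\<not> weight y \<le> weight z"
      then obtain q where "q \<in> \<rat>" "weight z < q" "q < weight y"
        using Rats_dense_in_real[of "weight z" "weight y"] by auto
      moreover from this have "y \<in> ?Z q"
        using x z unfolding fibre_def by fastforce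
      ultimately show False
        using y by auto
    qed
    with x show "y \<in> B n"
      by (auto simp: B_def)
  qed
  also have "\<dots> \<in> sets borel"
  proof (rule sets.Diff)
    have "?Z q - {y. weight y \<le> q} \<in> sets borel" for q
      by (intro sets.Diff borel_closed closed_saturation closed_weight_sublevel)
    then show "(\<Union>q\<in>\<rat>. ?Z q - {y. weight y \<le> q}) \<in> sets borel"
      using countable_rat by (intro sets.countable_UN') auto
  qed (intro borel_closed closed_fibres)
  finally show ?thesis .
qed

lemma B_fibre_eq:
  assumes "y \<in> B n" "y' \<in> B n" "y - t x \<in> K x" "y' - t x \<in> K x"
  shows "y = y'"
proof -
  have min: "u \<in> fibre n x \<and> (\<forall>z\<in>fibre n x. weight u \<le> weight z)" if u: "u \<in> B n" "u - t x \<in> K x" for u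
  proof -
    obtain x' where "u \<in> fibre n x'" "\<forall>z\<in>fibre n x'. weight u \<le> weight z"
      using u by (auto simp: B_def)
    moreover from this have "x' = x"
      using fibre_unique[of u x' u x] u by (simp add: fibre_def)
    ultimately show ?thesis
      by simp
  qed
  have "weight y = weight y'"
    using min[of y] min[of y'] assms by (meson order_antisym)
  then show ?thesis
    by (rule weight_inj)
qed

text \<open>The fibre is compact, being the part of a translate of \<open>K x\<close> outside an
  open set, so \<open>weight\<close> attains its minimum on it.\<close>

lemma B_meets_fibre:
  assumes "fibre n x \<noteq> {}"
  shows "\<exists>y\<in>B n. y \<notin> U n x"
proof -
  have "fibre n x = ((+) (t x) ` K x) \<inter> (- U n x)"
    by (auto simp: fibre_def image_iff) (metis add.commute diff_add_cancel)
  moreover have "compact ((+) (t x) ` K x)"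
    by (intro compact_continuous_image compact_K continuous_intros)
  ultimately have "compact (fibre n x)"
    using open_U by (simp add: compact_Int_closed closed_Compl)
  then obtain y where "y \<in> fibre n x" "\<forall>z\<in>fibre n x. weight y \<le> weight z"
    using closed_sublevels_attain_min[OF _ assms closed_weight_sublevel] by blast
  then show ?thesis
    by (auto simp: B_def fibre_def)
qed

section \<open>The translates of the selected set are null\<close>

lemma S_measurable: "S \<in> borel_measurable coin"
proof (rule borel_measurable_LIMSEQ_metric)
  show "(\<lambda>e. \<Sum>l<m. if e l then w l else 0) \<in> borel_measurable coin" for m
  proof (rule borel_measurable_sum)
    fix l
    have "(\<lambda>e. e l) \<in> measurable coin (measure_pmf (bernoulli_pmf (1 / 2)))"
      by (rule measurable_component_singleton) simp
    then show "(\<lambda>e. if e l then w l else 0) \<in> borel_measurable coin"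
      by (rule measurable_compose[where g = "\<lambda>c. if c then w l else 0"]) simp
  qed
  show "(\<lambda>m. \<Sum>l<m. if e l then w l else 0) \<longlonglongrightarrow> S e" for e
    unfolding S_def by (rule series_tendsto) (rule digit_in)
qed

text \<open>Two hits \<open>S e = y + g\<close> and \<open>S e' = y' + g\<close> give
  \<open>y + S e' = y' + S e\<close>; hence the codes agree, then the selected points, then
  \<open>e\<close> and \<open>e'\<close>.\<close>

lemma S_vimage_B_subset_singleton: "\<exists>e. S -` ((\<lambda>y. y + g) ` B n) \<subseteq> {e}"
proof -
  have "e = e'" if e: "S e \<in> (\<lambda>y. y + g) ` B n" "S e' \<in> (\<lambda>y. y + g) ` B n" for e e'
  proof -
    obtain y where y: "y \<in> B n" "S e = y + g"
      using e(1) by blast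
    obtain y' where y': "y' \<in> B n" "S e' = y' + g"
      using e(2) by blast
    obtain x where x: "y - t x \<in> K x"
      using y by (auto simp: B_def fibre_def)
    obtain x' where x': "y' - t x' \<in> K x'"
      using y' by (auto simp: B_def fibre_def)
    have "y + S e' = y' + S e"
      using y y' by (simp add: algebra_simps)
    then have "x = x'"
      using fibre_unique[OF x x'] by blast
    then have "y = y'"
      using B_fibre_eq[OF y(1) y'(1) x] x' by simp
    then show ?thesis
      using S_inj y y' by simp
  qed
  then show ?thesis
    by (metis insertI1 subsetI vimageD)
qed

lemma haar_null_B: "haar_null (\<Union>n. B n)"
  unfolding haar_null_def
proof (intro exI conjI allI)
  show "(\<Union>n. B n) \<in> sets borel"
    using B_borel by blast
  \<comment> \<open>The witnessing measure is the image of the coin-tossing measure on the Cantor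
    set.\<close>
  show "prob_space (distr coin borel S)"
    using coin_prob_space S_measurable by (rule prob_space.prob_space_distr)
  fix g
  have B_g: "(\<lambda>y. y + g) ` B n \<in> sets borel" for n
    using B_borel by (rule translate_borel)
  have "(\<lambda>y. y + g) ` B n \<in> null_sets (distr coin borel S)" for n
  proof (rule null_setsI)
    obtain e where "S -` ((\<lambda>y. y + g) ` B n) \<subseteq> {e}"
      using S_vimage_B_subset_singleton by blast
    then have "emeasure coin (S -` ((\<lambda>y. y + g) ` B n) \<inter> space coin) = 0"
      by (intro coin_subset_singleton_null) auto
    then show "emeasure (distr coin borel S) ((\<lambda>y. y + g) ` B n) = 0"
      using S_measurable B_g by (simp add: emeasure_distr)
  qed (use B_g in simp)
  then have "(\<Union>n. (\<lambda>y. y + g) ` B n) \<in> null_sets (distr coin borel S)"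
    by (rule null_sets_UN)
  then show "emeasure (distr coin borel S) ((\<lambda>x. x + g) ` (\<Union>n. B n)) = 0"
    by (simp add: image_UN null_setsD1)
qed auto

section \<open>Hulls of the selected set contain translates of all compact sets\<close>

lemma gdelta_hull_contains_translate:
  assumes "gdelta H" "(\<Union>n. B n) \<subseteq> H" "compact C"
  shows "\<exists>g. (\<lambda>c. c + g) ` C \<subseteq> H"
proof -
  obtain O' where O: "\<And>n :: nat. open (O' n)" "H = (\<Inter>n. O' n)"
    using assms(1) by (auto elim: gdelta.cases)
  obtain x where x: "C \<subseteq> K x" "\<And>n. U n x = O' n"
    using ex_code[of C O', OF assms(3) O(1)] by blast
  \<comment> \<open>Otherwise \<open>B n\<close> would contain a point outside \<open>U n x\<close>,
    that is, outside \<open>O' n\<close> and so outside \<open>H\<close>.\<close>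
  have "fibre n x = {}" for n
    using B_meets_fibre[of n x] x(2)[of n] assms(2) O(2) by blast
  then have "c + t x \<in> O' n" if "c \<in> C" for c n
    using that x unfolding fibre_def by (metis (mono_tags, lifting) add_diff_cancel_right' empty_Collect_eq subsetD)
  then show ?thesis
    using O(2) by blast
qed

end

text \<open>A translate of \<open>C\<close> inside \<open>H\<close> puts \<open>C\<close> inside a
  translate of \<open>B'\<close>, which is null; by inner regularity the whole space would have
  measure zero.\<close>

lemma not_haar_null_if_contains_compact_translates:
  fixes H :: "'a::{topological_ab_group_add, polish_space} set"
  assumes "\<And>C. compact C \<Longrightarrow> \<exists>g. (\<lambda>c. c + g) ` C \<subseteq> H"
  shows "\<not> haar_null H"
proof
  assume "haar_null H"
  then obtain B' \<mu> where B': "B' \<in> sets borel" "H \<subseteq> B'" and mu: "prob_space \<mu>" "sets \<mu> = sets borel"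
      and null: "\<And>g. emeasure \<mu> ((\<lambda>x. x + g) ` B') = 0"
    unfolding haar_null_def by blast
  interpret prob_space \<mu> by fact
  have "emeasure \<mu> C = 0" if "compact C" for C
  proof -
    obtain g where g: "(\<lambda>c. c + g) ` C \<subseteq> H"
      using assms \<open>compact C\<close> by blast
    have "C \<subseteq> (\<lambda>x. x + - g) ` B'"
    proof
      fix c assume "c \<in> C"
      then have "c + g \<in> B'"
        using g B' by blast
      then show "c \<in> (\<lambda>x. x + - g) ` B'"
        by (rule rev_image_eqI) simp
    qed
    then have "emeasure \<mu> C \<le> emeasure \<mu> ((\<lambda>x. x + - g) ` B')"
      using translate_borel[OF B'(1), of "- g"] mu(2) by (intro emeasure_mono) simp_all
    then show ?thesis
      unfolding null by simp
  qed
  moreover have "emeasure \<mu> UNIV = (SUP C\<in>{C. C \<subseteq> UNIV \<and> compact C}. emeasure \<mu> C)"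
    using mu(2) by (intro inner_regular) auto
  ultimately have "emeasure \<mu> UNIV \<le> 0"
    by (simp only: SUP_le_iff mem_Collect_eq) simp
  moreover have "space \<mu> = UNIV"
    using sets_eq_imp_space_eq[OF mu(2)] by simp
  ultimately show False
    using emeasure_space_1 by simp
qed

theorem theorem1p3:
  assumes "\<not> locally_compact_space (euclidean :: 'a::{topological_ab_group_add, polish_space} topology)"
  shows "\<exists>B :: 'a set. B \<in> sets borel \<and> haar_null B \<and>
           \<not> (\<exists>H :: 'a set. gdelta H \<and> haar_null H \<and> B \<subseteq> H)"
proof -
  obtain V d w \<tau> where "compact_coding V d (w :: nat \<Rightarrow> 'a) \<tau>"
    using ex_compact_coding[OF assms] by blast
  then interpret compact_coding V d w \<tau> .
  obtain \<B> :: "'a set set" where \<B>: "countable \<B>" "topological_basis \<B>"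
    using ex_countable_basis by blast
  then have "\<B> \<noteq> {}"
    using topological_basisE[OF \<B>(2), of UNIV 0] by auto
  then have range: "range (from_nat_into \<B>) = \<B>"
    using \<B>(1) by (rule range_from_nat_into)
  interpret hull_coding V d w \<tau> "from_nat_into \<B>"
  proof
    show "open (from_nat_into \<B> j)" for j
      using range \<B>(2) topological_basis_open by blast
    show "\<exists>j. a \<in> from_nat_into \<B> j \<and> from_nat_into \<B> j \<subseteq> O'" if "open O'" "a \<in> O'" for O' a
      using topological_basisE[OF \<B>(2) that] range by (metis rangeE)
  qed
  have "\<not> haar_null H" if "gdelta H" "(\<Union>n. B n) \<subseteq> H" for H
    using gdelta_hull_contains_translate[OF that]
    by (rule not_haar_null_if_contains_compact_translates)
  moreover have "(\<Union>n. B n) \<in> sets borel"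
    using B_borel by blast
  ultimately show ?thesis
    using haar_null_B by blast
qed

end
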